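(* Consider a cake-cutting instance with $n$ hungry agents with equal entitlements ($w_i=1/n$ for all $i$). Then a connected strongly-proportional allocation exists if and only if there exist two distinct agents $i,j\in[n]$ and $r\in\{1/n,2/n,\dots,(n-1)/n\}$ such that the $r$-mark of agent $i$ is different from the $r$-mark of agent $j$.
   Context: The cake is $C=[0,1]$, to be divided among agents $[n]$. Each agent $i$ has a valuation function $V_i$ on the algebra generated by intervals of $C$ that is non-negative, finitely additive, normalized ($V_i(C)=1$), with $x\mapsto V_i([0,x])$ continuous. Agent $i$ is hungry if $V_i(X)>0$ for every interval $X$ of positive length. For $r\in[0,1]$, a point $x\in C$ is an $r$-mark of agent $i$ if $V_i([0,x])=r$; for hungry agents it is unique. Entitlements $w_i>0$ sum to $1$. An allocation is a partition $C=X_1\sqcup\cdots\sqcup X_n$ into finite unions of closed intervals, pairwise disjoint except possibly at endpoints; it is connected if every $X_i$ is a single interval; it is strongly-proportional if $V_i(X_i)>w_i$ for all $i$. *)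

theory Defs
  imports "HOL-Analysis.Analysis"
begin

definition cake :: "real set" where
  "cake = {0..1}"

definition cake_intervals :: "real set set" where
  "cake_intervals = {X. is_interval X \<and> X \<subseteq> cake}"

definition cake_algebra :: "real set set" where
  "cake_algebra = \<Inter>{M. algebra cake M \<and> cake_intervals \<subseteq> M}"

text \<open>
  Continuity of \<open>x \<mapsto> V [0,x]\<close> on the cake excludes atoms at every point except \<open>0\<close>. The condition
  \<open>V {0} = 0\<close> says that this function starts at \<open>0\<close>; it is equivalent to the existence of
  an \<open>r\<close>-mark for every \<open>r \<in> [0,1]\<close>. Values of \<open>V\<close> outside \<open>cake_algebra\<close> are irrelevant.
\<close>

definition valuation :: "(real set \<Rightarrow> real) \<Rightarrow> bool" where
  "valuation V \<longleftrightarrow>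
     (\<forall>X\<in>cake_algebra. 0 \<le> V X) \<and>
     (\<forall>X\<in>cake_algebra. \<forall>Y\<in>cake_algebra. X \<inter> Y = {} \<longrightarrow> V (X \<union> Y) = V X + V Y) \<and>
     V cake = 1 \<and>
     continuous_on cake (\<lambda>x. V {0..x}) \<and>
     V {0} = 0"

definition hungry :: "(real set \<Rightarrow> real) \<Rightarrow> bool" where
  "hungry V \<longleftrightarrow> (\<forall>X\<in>cake_intervals. 0 < measure lborel X \<longrightarrow> 0 < V X)"

definition is_mark :: "(real set \<Rightarrow> real) \<Rightarrow> real \<Rightarrow> real \<Rightarrow> bool" where
  "is_mark V r x \<longleftrightarrow> x \<in> cake \<and> V {0..x} = r"

definition cake_instance :: "nat \<Rightarrow> (nat \<Rightarrow> real set \<Rightarrow> real) \<Rightarrow> (nat \<Rightarrow> real) \<Rightarrow> bool" where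
  "cake_instance n V w \<longleftrightarrow>
     (\<forall>i\<in>{1..n}. valuation (V i)) \<and> (\<forall>i\<in>{1..n}. 0 < w i) \<and> (\<Sum>i=1..n. w i) = 1"

definition finite_union_of_closed_intervals :: "real set \<Rightarrow> bool" where
  "finite_union_of_closed_intervals X \<longleftrightarrow>
     (\<exists>F. finite F \<and> (\<forall>I\<in>F. \<exists>a b. a \<le> b \<and> I = {a..b}) \<and> X = \<Union>F)"

text \<open>
  For a finite union of closed intervals, the topological frontier is the set of endpoints of its
  maximal subintervals.
\<close>

definition allocation :: "nat \<Rightarrow> (nat \<Rightarrow> real set) \<Rightarrow> bool" where
  "allocation n X \<longleftrightarrow>
     (\<forall>i\<in>{1..n}. finite_union_of_closed_intervals (X i)) \<and>
     (\<Union>i\<in>{1..n}. X i) = cake \<and>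
     (\<forall>i\<in>{1..n}. \<forall>j\<in>{1..n}. i \<noteq> j \<longrightarrow> X i \<inter> X j \<subseteq> frontier (X i) \<inter> frontier (X j))"

definition connected_allocation :: "nat \<Rightarrow> (nat \<Rightarrow> real set) \<Rightarrow> bool" where
  "connected_allocation n X \<longleftrightarrow> allocation n X \<and> (\<forall>i\<in>{1..n}. is_interval (X i))"

definition strongly_proportional ::
  "nat \<Rightarrow> (nat \<Rightarrow> real set \<Rightarrow> real) \<Rightarrow> (nat \<Rightarrow> real) \<Rightarrow> (nat \<Rightarrow> real set) \<Rightarrow> bool" where
  "strongly_proportional n V w X \<longleftrightarrow> (\<forall>i\<in>{1..n}. w i < V i (X i))"

lemma interval_in_cake_algebra: "X \<in> cake_intervals \<Longrightarrow> X \<in> cake_algebra"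
  unfolding cake_algebra_def by blast

lemma is_mark_ex1:
  assumes V: "valuation V" and h: "hungry V" and r: "r \<in> {0..1}"
  shows "\<exists>!x. is_mark V r x"
proof -
  have "continuous_on {0..1} (\<lambda>x. V {0..x})" "V {0..0} \<le> r" "r \<le> V {0..1}"
    using V r by (auto simp: valuation_def cake_def)
  then obtain x where x: "is_mark V r x"
    using IVT'[of "\<lambda>x. V {0..x}" 0 r 1] by (auto simp: is_mark_def cake_def)
  have less: "V {0..y} < V {0..z}" if yz: "0 \<le> y" "y < z" "z \<le> 1" for y z
  proof -
    have int: "{0..y} \<in> cake_intervals" "{y<..z} \<in> cake_intervals"
      using yz by (auto simp: cake_intervals_def cake_def is_interval_def)
    have "{0..z} = {0..y} \<union> {y<..z}" "{0..y} \<inter> {y<..z} = {}"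
      using yz by auto
    moreover have "0 < V {y<..z}"
      using h int(2) yz by (auto simp: hungry_def)
    ultimately show ?thesis
      using V int[THEN interval_in_cake_algebra] by (auto simp: valuation_def)
  qed
  have "y = x" if "is_mark V r y" for y
    using x that less[of x y] less[of y x] by (cases x y rule: linorder_cases) (auto simp: is_mark_def cake_def)
  with x show ?thesis
    by blast
qed

end

theory Submission
  imports Defs
begin

text \<open>
  Write \<open>F\<^sub>i x = V\<^sub>i [0,x]\<close>. If all agents have the same \<open>k/n\<close>-marks, then a piece worth more than
  \<open>1/n\<close> to its owner has one of the \<open>n - 1\<close> common marks in its interior, so among \<open>n\<close> such pieces
  two overlap. Conversely, if the \<open>k/n\<close>-marks are not all equal, let \<open>z\<close> be the \<open>k\<close>-th smallest of
  them. Cutting at \<open>z\<close> leaves \<open>k\<close> agents on the left and \<open>n - k\<close> on the right, each of whom values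
  his side at least at his fair share, and one of them strictly more. A surplus of a single
  agent suffices to give every agent of his side a surplus, by a last-diminisher argument. Since
  strict inequalities survive a small move of the cut \<open>z\<close>, the surplus passes to the other side.
\<close>

section \<open>Valuations as distribution functions\<close>

lemma interval_cake_algebra: "is_interval X \<Longrightarrow> X \<subseteq> {0..1} \<Longrightarrow> X \<in> cake_algebra"
  by (rule interval_in_cake_algebra) (simp add: cake_intervals_def cake_def)

lemma valuation_split:
  assumes "valuation V" "is_interval X" "is_interval Y" "X \<subseteq> {0..1}" "Y \<subseteq> {0..1}" "X \<inter> Y = {}"
  shows "V (X \<union> Y) = V X + V Y"
  using assms interval_cake_algebra unfolding valuation_def by blast

lemma valuation_nonneg:
  assumes "valuation V" "is_interval X" "X \<subseteq> {0..1}"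
  shows "0 \<le> V X"
  using assms interval_cake_algebra unfolding valuation_def by blast

lemma valuation_empty:
  assumes "valuation V"
  shows "V {} = 0"
  using valuation_split[OF assms, of "{}" "{}"] by simp

lemma is_interval_Ioc_real: "is_interval {a<..b::real}"
  by (auto simp: is_interval_1)

lemma valuation_Ioc:
  assumes V: "valuation V" and ab: "0 \<le> a" "a \<le> b" "b \<le> 1"
  shows "V {a<..b} = V {0..b} - V {0..a}"
proof -
  have "V ({0..a} \<union> {a<..b}) = V {0..a} + V {a<..b}"
    by (rule valuation_split[OF V]) (use ab in \<open>auto simp: is_interval_Ioc_real is_interval_cc\<close>)
  moreover have "{0..a} \<union> {a<..b} = {0..b}"
    using ab by auto
  ultimately show ?thesis by simp
qed

text \<open>\<open>{a}\<close> lies in \<open>{y<..a}\<close>, whose value tends to 0 as y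
  approaches a from the left, by continuity. The point 0 has no left neighbours in the cake; there
  the claim is a clause of \<open>valuation\<close>.\<close>

lemma valuation_singleton:
  assumes V: "valuation V" and a: "0 \<le> a" "a \<le> 1"
  shows "V {a} = 0"
proof (cases "a = 0")
  case True
  then show ?thesis using V by (simp add: valuation_def)
next
  case False
  with a have a0: "0 < a" by simp
  have le: "V {a} \<le> V {0..a} - V {0..y}" if y: "0 \<le> y" "y < a" for y
  proof -
    have "V ({y<..<a} \<union> {a}) = V {y<..<a} + V {a}"
      by (rule valuation_split[OF V]) (use y a in \<open>auto simp: is_interval_1\<close>)
    moreover have "{y<..<a} \<union> {a} = {y<..a}"
      using y by auto
    moreover have "0 \<le> V {y<..<a}"
      by (rule valuation_nonneg[OF V]) (use y a in \<open>auto simp: is_interval_1\<close>)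
    ultimately show ?thesis
      using valuation_Ioc[OF V, of y a] y a by simp
  qed
  have "continuous_on {0..a} (\<lambda>x. V {0..x})"
    using V a by (auto simp: valuation_def cake_def intro: continuous_on_subset)
  then have "((\<lambda>x. V {0..x}) \<longlongrightarrow> V {0..a}) (at_left a)"
    using a0 by (rule continuous_on_Icc_at_leftD)
  then have lim: "((\<lambda>y. V {0..a} - V {0..y}) \<longlongrightarrow> V {0..a} - V {0..a}) (at_left a)"
    by (intro tendsto_intros)
  have "eventually (\<lambda>y. y \<in> {0<..<a}) (at_left a)"
    using eventually_at_left_real[OF a0] .
  then have "eventually (\<lambda>y. V {a} \<le> V {0..a} - V {0..y}) (at_left a)"
    by eventually_elim (simp add: le)
  then have "V {a} \<le> V {0..a} - V {0..a}"
    by (rule tendsto_lowerbound[OF lim]) simp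
  moreover have "0 \<le> V {a}"
    by (rule valuation_nonneg[OF V]) (use a in \<open>auto simp: is_interval_1\<close>)
  ultimately show ?thesis by simp
qed

text \<open>Closed pieces may share endpoints; as points are worthless, their values are still
  differences of the distribution function.\<close>

lemma valuation_Icc:
  assumes V: "valuation V" and ab: "0 \<le> a" "a \<le> b" "b \<le> 1"
  shows "V {a..b} = V {0..b} - V {0..a}"
proof -
  have "V ({a} \<union> {a<..b}) = V {a} + V {a<..b}"
    by (rule valuation_split[OF V]) (use ab in \<open>auto simp: is_interval_1\<close>)
  moreover have "{a} \<union> {a<..b} = {a..b}"
    using ab by auto
  ultimately show ?thesis
    using valuation_Ioc[OF V ab] valuation_singleton[OF V, of a] ab by simp
qed

lemma hungry_strict_mono:
  assumes V: "valuation V" and h: "hungry V"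
  shows "strict_mono_on {0..1} (\<lambda>x. V {0..x})"
proof (rule strict_mono_onI)
  fix a b :: real assume ab: "a \<in> {0..1}" "b \<in> {0..1}" "a < b"
  then have "{a<..b} \<in> cake_intervals"
    by (auto simp: cake_intervals_def cake_def is_interval_1)
  then have "0 < V {a<..b}"
    using h ab by (auto simp: hungry_def)
  then show "V {0..a} < V {0..b}"
    using valuation_Ioc[OF V, of a b] ab by simp
qed

section \<open>Connected divisions of a subinterval\<close>

text \<open>
  \<open>divides F t A a b\<close>: the interval \<open>[a,b]\<close> can be cut into one interval for each agent in \<open>A\<close>, each
  worth more than \<open>t\<close> to its owner. Building divisions by concatenation makes it easy to reach
  the first and the last piece.
\<close>

inductive divides :: "('i \<Rightarrow> real \<Rightarrow> real) \<Rightarrow> real \<Rightarrow> 'i set \<Rightarrow> real \<Rightarrow> real \<Rightarrow> bool"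
  for F :: "'i \<Rightarrow> real \<Rightarrow> real" and t :: real where
  single: "0 \<le> a \<Longrightarrow> a < b \<Longrightarrow> b \<le> 1 \<Longrightarrow> F i a + t < F i b \<Longrightarrow> divides F t {i} a b"
| concat: "divides F t A a c \<Longrightarrow> divides F t B c b \<Longrightarrow> A \<inter> B = {} \<Longrightarrow> divides F t (A \<union> B) a b"

lemma divides_bounds: "divides F t A a b \<Longrightarrow> 0 \<le> a \<and> a < b \<and> b \<le> 1"
  by (induction rule: divides.induct) auto

text \<open>The strict inequality of the first piece survives a small move of its left endpoint, and
  no other piece is touched. This frees cake for a neighbour on the left.\<close>

lemma divides_shrink_left:
  assumes "divides F t A a b" "\<And>i. i \<in> A \<Longrightarrow> continuous_on {0..1} (F i)"
  shows "\<exists>a'. a < a' \<and> a' < b \<and> divides F t A a' b"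
  using assms
proof (induction rule: divides.induct)
  case (single a b i)
  have "continuous_on {a..b} (F i)"
    using single by (auto intro: continuous_on_subset)
  then have "(F i \<longlongrightarrow> F i a) (at_right a)"
    using \<open>a < b\<close> by (rule continuous_on_Icc_at_rightD)
  then have "eventually (\<lambda>x. F i x < F i b - t) (at_right a)"
    by (rule order_tendstoD) (use single in simp)
  moreover have "eventually (\<lambda>x. x \<in> {a<..<b}) (at_right a)"
    using eventually_at_right_real[OF \<open>a < b\<close>] .
  ultimately have "eventually (\<lambda>x. x \<in> {a<..<b} \<and> F i x < F i b - t) (at_right a)"
    by eventually_elim simp
  then obtain x where "x \<in> {a<..<b}" "F i x < F i b - t"
    using eventually_happens'[OF trivial_limit_at_right_real] by blast
  then show ?case
    using single by (intro exI[of _ x]) (auto intro!: divides.single)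
next
  case (concat A a c B b)
  then obtain a' where "a < a'" "a' < c" "divides F t A a' c"
    by auto
  moreover have "c < b"
    using concat.hyps(1,2)[THEN divides_bounds] by auto
  ultimately show ?case
    using concat by (intro exI[of _ a']) (auto intro: divides.concat)
qed

text \<open>Mirror image: only the last piece moves, so the induction descends into the right-hand
  part.\<close>

lemma divides_shrink_right:
  assumes "divides F t A a b" "\<And>i. i \<in> A \<Longrightarrow> continuous_on {0..1} (F i)"
  shows "\<exists>b'. a < b' \<and> b' < b \<and> divides F t A a b'"
  using assms
proof (induction rule: divides.induct)
  case (single a b i)
  have "continuous_on {a..b} (F i)"
    using single by (auto intro: continuous_on_subset)
  then have "(F i \<longlongrightarrow> F i b) (at_left b)"
    using \<open>a < b\<close> by (rule continuous_on_Icc_at_leftD)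
  then have "eventually (\<lambda>x. F i a + t < F i x) (at_left b)"
    by (rule order_tendstoD) (use single in simp)
  moreover have "eventually (\<lambda>x. x \<in> {a<..<b}) (at_left b)"
    using eventually_at_left_real[OF \<open>a < b\<close>] .
  ultimately have "eventually (\<lambda>x. x \<in> {a<..<b} \<and> F i a + t < F i x) (at_left b)"
    by eventually_elim simp
  then obtain x where "x \<in> {a<..<b}" "F i a + t < F i x"
    using eventually_happens'[OF trivial_limit_at_left_real] by blast
  then show ?case
    using single by (intro exI[of _ x]) (auto intro!: divides.single)
next
  case (concat A a c B b)
  then obtain b' where "c < b'" "b' < b" "divides F t B c b'"
    by auto
  moreover have "a < c"
    using concat.hyps(1,2)[THEN divides_bounds] by auto
  ultimately show ?case
    using concat by (intro exI[of _ b']) (auto intro: divides.concat)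
qed

text \<open>Recovers explicit endpoints from the inductive construction. The order of endpoints in
  the last clause lets pieces touch, which is what the frontier condition of
  \<open>allocation\<close> permits.\<close>

lemma divides_pieces:
  assumes "divides F t A a b"
  shows "\<exists>l r. (\<forall>i\<in>A. a \<le> l i \<and> l i < r i \<and> r i \<le> b \<and> F i (l i) + t < F i (r i)) \<and>
    (\<Union>i\<in>A. {l i..r i}) = {a..b} \<and> (\<forall>i\<in>A. \<forall>j\<in>A. i \<noteq> j \<longrightarrow> r i \<le> l j \<or> r j \<le> l i)"
  using assms
proof (induction rule: divides.induct)
  case (single a b i)
  then show ?case
    by (intro exI[of _ "\<lambda>_. a"] exI[of _ "\<lambda>_. b"]) auto
next
  case (concat A a c B b)
  from concat.IH(1) obtain l r where
    A: "\<forall>i\<in>A. a \<le> l i \<and> l i < r i \<and> r i \<le> c \<and> F i (l i) + t < F i (r i)"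
      "(\<Union>i\<in>A. {l i..r i}) = {a..c}" "\<forall>i\<in>A. \<forall>j\<in>A. i \<noteq> j \<longrightarrow> r i \<le> l j \<or> r j \<le> l i"
    by (elim exE conjE)
  from concat.IH(2) obtain l' r' where
    B: "\<forall>i\<in>B. c \<le> l' i \<and> l' i < r' i \<and> r' i \<le> b \<and> F i (l' i) + t < F i (r' i)"
      "(\<Union>i\<in>B. {l' i..r' i}) = {c..b}" "\<forall>i\<in>B. \<forall>j\<in>B. i \<noteq> j \<longrightarrow> r' i \<le> l' j \<or> r' j \<le> l' i"
    by (elim exE conjE)
  define L where "L i = (if i \<in> A then l i else l' i)" for i
  define R where "R i = (if i \<in> A then r i else r' i)" for i
  have c: "a < c" "c < b"
    using concat.hyps(1,2)[THEN divides_bounds] by auto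
  have LA: "L i = l i" "R i = r i" if "i \<in> A" for i
    using that by (auto simp: L_def R_def)
  have LB: "L i = l' i" "R i = r' i" if "i \<in> B" for i
    using that concat.hyps by (auto simp: L_def R_def)
  have "(\<Union>i\<in>A \<union> B. {L i..R i}) = (\<Union>i\<in>A. {l i..r i}) \<union> (\<Union>i\<in>B. {l' i..r' i})"
    by (simp add: UN_Un LA LB)
  also have "\<dots> = {a..b}"
    using A(2) B(2) c by auto
  finally have union: "(\<Union>i\<in>A \<union> B. {L i..R i}) = {a..b}" .
  have piece: "a \<le> L i \<and> L i < R i \<and> R i \<le> b \<and> F i (L i) + t < F i (R i)" if "i \<in> A \<union> B" for i
    using that bspec[OF A(1), of i] bspec[OF B(1), of i] c by (auto simp: LA LB)
  have disj: "R i \<le> L j \<or> R j \<le> L i" if ij: "i \<in> A \<union> B" "j \<in> A \<union> B" "i \<noteq> j" for i j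
  proof -
    consider "i \<in> A" "j \<in> A" | "i \<in> A" "j \<in> B" | "i \<in> B" "j \<in> A" | "i \<in> B" "j \<in> B"
      using ij by blast
    then show ?thesis
    proof cases
      case 1
      then show ?thesis using A(3) ij by (simp add: LA)
    next
      case 2
      then show ?thesis using bspec[OF A(1), of i] bspec[OF B(1), of j] by (auto simp: LA LB)
    next
      case 3
      then show ?thesis using bspec[OF A(1), of j] bspec[OF B(1), of i] by (auto simp: LA LB)
    next
      case 4
      then show ?thesis using B(3) ij by (simp add: LB)
    qed
  qed
  have "\<forall>i\<in>A \<union> B. a \<le> L i \<and> L i < R i \<and> R i \<le> b \<and> F i (L i) + t < F i (R i)"
    using piece by simp
  moreover have "\<forall>i\<in>A \<union> B. \<forall>j\<in>A \<union> B. i \<noteq> j \<longrightarrow> R i \<le> L j \<or> R j \<le> L i"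
    using disj by simp
  ultimately show ?case
    using union by (intro exI[of _ L] exI[of _ R] conjI)
qed

text \<open>
  The agent whose \<open>t\<close>-mark is leftmost takes the piece up to that mark. This agent can be chosen so
  that somebody with a surplus remains; the surplus the induction hypothesis then gives to the
  owner of the next piece allows the cut to be moved to the right.
\<close>

lemma divides_if_surplus:
  assumes "finite A" "0 < t" "0 \<le> a" "a < b" "b \<le> 1"
    and "\<And>i. i \<in> A \<Longrightarrow> continuous_on {0..1} (F i)"
    and "\<And>i. i \<in> A \<Longrightarrow> strict_mono_on {0..1} (F i)"
    and "\<And>i. i \<in> A \<Longrightarrow> F i a + real (card A) * t \<le> F i b"
    and "\<exists>i\<in>A. F i a + real (card A) * t < F i b"
  shows "divides F t A a b"
  using assms
\<comment> \<open>Pieces are removed from the left only, so \<open>a\<close> varies and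
  \<open>b\<close> stays fixed.\<close>
proof (induction "card A" arbitrary: A a)
  case 0
  then show ?case by auto
next
  case (Suc m)
  note cont = Suc.prems(6) and mono = Suc.prems(7) and ge = Suc.prems(8)
  show ?case
  proof (cases "m = 0")
    case True
    then obtain i where "A = {i}"
      using Suc.hyps(2) by (metis One_nat_def card_1_singletonE)
    then show ?thesis
      using Suc.prems by (auto intro: divides.single)
  next
    case False
    have card: "real (card A) = real m + 1"
      using Suc.hyps(2) by simp
    have mt: "0 < real m * t"
      using False Suc.prems by simp
    have "\<exists>x. a < x \<and> x < b \<and> F i x = F i a + t" if i: "i \<in> A" for i
    proof -
      have "continuous_on {a..b} (F i)"
        using cont[OF i] Suc.prems by (auto intro: continuous_on_subset)
      moreover have lt: "F i a + t < F i b"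
        using ge[OF i] mt by (simp add: card algebra_simps)
      ultimately obtain x where x: "a \<le> x" "x \<le> b" "F i x = F i a + t"
        using IVT'[of "F i" a "F i a + t" b] Suc.prems by auto
      moreover have "x \<noteq> a" "x \<noteq> b"
        using x lt Suc.prems by auto
      ultimately show ?thesis by force
    qed
    then obtain x where x: "\<And>i. i \<in> A \<Longrightarrow> a < x i \<and> x i < b \<and> F i (x i) = F i a + t"
      by metis
    from Suc.prems obtain s where s: "s \<in> A" "F s a + real (card A) * t < F s b"
      by blast
    \<comment> \<open>\<open>j\<close> leaves with the first piece and \<open>p\<close> is to carry
      a surplus into the rest. If some mark lies beyond the leftmost one, its owner serves as
      \<open>p\<close>. Otherwise all marks coincide, and \<open>j\<close> can be any agent other
      than \<open>s\<close>, leaving \<open>p = s\<close>.\<close>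
    obtain j p where j: "j \<in> A" "p \<in> A" "p \<noteq> j" "\<And>i. i \<in> A \<Longrightarrow> x j \<le> x i"
      and p: "x j < x p \<or> p = s"
    proof -
      obtain j where j: "j \<in> A" "\<And>i. i \<in> A \<Longrightarrow> x j \<le> x i"
        using arg_min_if_finite(1)[of A] arg_min_least[of A] Suc.prems(1) s(1)
        by (metis empty_iff)
      show thesis
      proof (cases "\<exists>p\<in>A. x j < x p")
        case True
        then show thesis using j that by blast
      next
        case all_eq: False
        have "A \<noteq> {s}"
          using False Suc.hyps(2) by auto
        then obtain q where "q \<in> A" "q \<noteq> s"
          using s(1) by blast
        then show thesis
          using that[of q s] all_eq j s(1) by (metis linorder_not_less order.trans)
      qed
    qed
    define c where "c = x j"
    have c: "a < c" "c < b" "F j c = F j a + t"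
      using x[OF j(1)] by (auto simp: c_def)
    have cA: "card (A - {j}) = m"
      using Suc.hyps(2) Suc.prems(1) j(1) by simp
    have mono_le: "F i u \<le> F i v" if "i \<in> A" "0 \<le> u" "u \<le> v" "v \<le> 1" for i u v
      using strict_mono_on_leD[OF mono[OF that(1)]] that by auto
    have Fc: "F i c \<le> F i a + t" if i: "i \<in> A" for i
      using mono_le[OF i, of c "x i"] x[OF i] j(4)[OF i] c Suc.prems by (simp add: c_def)
    \<comment> \<open>Among the \<open>m\<close> remaining agents, \<open>s\<close> keeps the
      initial surplus because at most \<open>t\<close> was cut away, while a later mark means that
      strictly less than \<open>t\<close> was cut away.\<close>
    have strict: "F p c + real m * t < F p b"
    proof (cases "p = s")
      case True
      then show ?thesis
        using Fc[OF s(1)] s(2) by (simp add: card algebra_simps)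
    next
      case False
      then have "F p c < F p (x p)"
        using p x[OF j(2)] c Suc.prems
        by (intro strict_mono_onD[OF mono[OF j(2)]]) (auto simp: c_def)
      then show ?thesis
        using x[OF j(2)] ge[OF j(2)] by (simp add: card algebra_simps)
    qed
    have "divides F t (A - {j}) c b"
    proof (rule Suc.hyps(1))
      show "F i c + real (card (A - {j})) * t \<le> F i b" if "i \<in> A - {j}" for i
        using Fc[of i] ge[of i] that unfolding cA by (simp add: card algebra_simps)
      show "\<exists>i\<in>A - {j}. F i c + real (card (A - {j})) * t < F i b"
        using strict j unfolding cA by blast
    qed (use cA Suc.prems c in auto)
    \<comment> \<open>At \<open>c\<close> the piece of \<open>j\<close> is worth exactly
      \<open>t\<close>. The others can spare the strip up to \<open>c'\<close>, which makes it worth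
      more.\<close>
    then obtain c' where c': "c < c'" "c' < b" "divides F t (A - {j}) c' b"
      using divides_shrink_left[of F t "A - {j}" c b] cont by auto
    have "F j c < F j c'"
      using c c' Suc.prems by (intro strict_mono_onD[OF mono[OF j(1)]]) auto
    then have "divides F t {j} a c'"
      using c c' Suc.prems by (intro divides.single) auto
    then have "divides F t ({j} \<union> (A - {j})) a b"
      using c'(3) by (rule divides.concat) simp
    then show ?thesis
      using j(1) by (simp add: insert_absorb)
  qed
qed

section \<open>Agents with different marks\<close>

text \<open>Because of ties, a level set of \<open>m\<close> may have the wrong size; adding one
  minimal remaining element at a time gives exactly \<open>k\<close> elements.\<close>

lemma exists_lower_subset:
  fixes m :: "'i \<Rightarrow> 'a::linorder"
  assumes "finite A" "k \<le> card A"
  shows "\<exists>L\<subseteq>A. card L = k \<and> (\<forall>i\<in>L. \<forall>j\<in>A - L. m i \<le> m j)"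
  using assms(2)
proof (induction k)
  case 0
  then show ?case by (intro exI[of _ "{}"]) auto
next
  case (Suc k)
  then obtain L where L: "L \<subseteq> A" "card L = k" "\<forall>i\<in>L. \<forall>j\<in>A - L. m i \<le> m j"
    by auto
  have fin: "finite L" "finite (A - L)"
    using L(1) assms(1) finite_subset by auto
  have "A - L \<noteq> {}"
    using Suc.prems L fin by (metis Diff_eq_empty_iff card_mono not_less_eq_eq order_refl)
  then obtain q where q: "q \<in> A - L" "\<And>i. i \<in> A - L \<Longrightarrow> m q \<le> m i"
    using arg_min_if_finite(1)[of "A - L"] arg_min_least[of "A - L"] fin by metis
  show ?case
    using L q fin by (intro exI[of _ "insert q L"]) auto
qed

text \<open>Both sides of the cut fit \<open>divides_if_surplus\<close> with
  \<open>t = 1 / n\<close>: the \<open>k\<close> agents on the left together need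
  \<open>k / n\<close>, the others \<open>1 - k / n\<close>. Both groups are non-empty as
  \<open>0 < k < n\<close>.\<close>

lemma divides_if_different_marks:
  fixes F :: "'i \<Rightarrow> real \<Rightarrow> real"
  assumes fin: "finite A" and n: "card A = n" and k: "0 < k" "k < n"
    and cont: "\<And>i. i \<in> A \<Longrightarrow> continuous_on {0..1} (F i)"
    and mono: "\<And>i. i \<in> A \<Longrightarrow> strict_mono_on {0..1} (F i)"
    and F0: "\<And>i. i \<in> A \<Longrightarrow> F i 0 = 0" and F1: "\<And>i. i \<in> A \<Longrightarrow> F i 1 = 1"
    and m: "\<And>i. i \<in> A \<Longrightarrow> m i \<in> {0..1} \<and> F i (m i) = real k / real n"
    and diff: "p \<in> A" "q \<in> A" "m p \<noteq> m q"
  shows "divides F (1 / real n) A 0 1"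
proof -
  have m01: "0 < m i" "m i < 1" if i: "i \<in> A" for i
  proof -
    have "0 < F i (m i)" "F i (m i) < 1"
      using m[OF i] k by auto
    then have "m i \<noteq> 0" "m i \<noteq> 1"
      using F0[OF i] F1[OF i] by auto
    then show "0 < m i" "m i < 1"
      using m[OF i] by auto
  qed
  obtain L where L: "L \<subseteq> A" "card L = k" "\<And>i j. i \<in> L \<Longrightarrow> j \<in> A - L \<Longrightarrow> m i \<le> m j"
    using exists_lower_subset[OF fin, of k m] k n by auto
  have finL: "finite L" "finite (A - L)"
    using L(1) fin finite_subset by auto
  have R: "card (A - L) = n - k" and Rr: "real (card (A - L)) = real n - real k"
    using L n fin finL k by (simp_all add: card_Diff_subset of_nat_diff)
  have "L \<noteq> {}"
    using L k by auto
  \<comment> \<open>This maximum is attained in \<open>L\<close>, so it is the mark of some agent: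
    it lies strictly inside the cake and is at most every mark outside \<open>L\<close>.\<close>
  define z where "z = Max (m ` L)"
  have zL: "m i \<le> z" if "i \<in> L" for i
    using that finL by (simp add: z_def)
  have "z \<in> m ` L"
    unfolding z_def using finL \<open>L \<noteq> {}\<close> by (intro Max_in) auto
  then obtain e where e: "e \<in> L" "z = m e"
    by blast
  have zR: "z \<le> m i" if "i \<in> A - L" for i
    using L(3)[OF e(1) that] e by simp
  have z: "0 < z" "z < 1"
    using m01 e L(1) by auto
  have n0: "0 < real n"
    using k by simp
  have less: "F i u < F i v" if "i \<in> A" "0 \<le> u" "u < v" "v \<le> 1" for i u v
    using that by (intro strict_mono_onD[OF mono[OF that(1)]]) auto
  \<comment> \<open>The two share facts hold for any cut \<open>u\<close> strictly on the favourable
    side of the mark, so they serve both for \<open>z\<close> and for the shifted cut.\<close>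
  have left_share: "F i 0 + real (card L) * (1 / real n) < F i u" if "i \<in> L" "m i < u" "u \<le> 1" for i u
    using less[of i "m i" u] m[of i] F0[of i] that L by auto
  have right_share: "F i u + real (card (A - L)) * (1 / real n) < F i 1"
    if "i \<in> A - L" "0 \<le> u" "u < m i" for i u
    using less[of i u "m i"] m[of i] F1[of i] that n0 unfolding Rr
    by (auto simp: diff_divide_distrib)
  have left_ge: "F i 0 + real (card L) * (1 / real n) \<le> F i z" if "i \<in> L" for i
    using left_share[of i z] zL[of i] that z m[of i] F0[of i] L by (cases "m i = z") auto
  have right_ge: "F i z + real (card (A - L)) * (1 / real n) \<le> F i 1" if "i \<in> A - L" for i
    using right_share[of i z] zR[of i] that z m[of i] F1[of i] n0 Rr
    by (cases "m i = z") (auto simp: diff_divide_distrib)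
  have left: "divides F (1 / real n) L 0 u"
    if "0 < u" "u \<le> 1" "\<And>i. i \<in> L \<Longrightarrow> F i 0 + real (card L) * (1 / real n) \<le> F i u"
      "\<exists>i\<in>L. F i 0 + real (card L) * (1 / real n) < F i u" for u
    using that finL n0 cont mono L(1) by (intro divides_if_surplus) auto
  have right: "divides F (1 / real n) (A - L) u 1"
    if "0 \<le> u" "u < 1" "\<And>i. i \<in> A - L \<Longrightarrow> F i u + real (card (A - L)) * (1 / real n) \<le> F i 1"
      "\<exists>i\<in>A - L. F i u + real (card (A - L)) * (1 / real n) < F i 1" for u
    using that finL n0 cont mono L(1) by (intro divides_if_surplus) auto
  have "\<exists>u. divides F (1 / real n) L 0 u \<and> divides F (1 / real n) (A - L) u 1"
  proof -
    \<comment> \<open>Two different marks cannot both equal \<open>z\<close>. The agent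
      \<open>s\<close> has a surplus on the side it belongs to.\<close>
    obtain s where s: "s \<in> A" "m s \<noteq> z"
      using diff by metis
    show ?thesis
    proof (cases "s \<in> L")
      case True
      then have "m s < z"
        using zL s by force
      then have "F s 0 + real (card L) * (1 / real n) < F s z"
        using left_share[OF True, of z] z by simp
      then have "divides F (1 / real n) L 0 z"
        using z True by (intro left left_ge) auto
      \<comment> \<open>Every mark on the right is at least \<open>z\<close>, so moving the cut to
        \<open>u < z\<close> gives all agents there a surplus.\<close>
      then obtain u where u: "0 < u" "u < z" "divides F (1 / real n) L 0 u"
        using divides_shrink_right[of F "1 / real n" L 0 z] cont L(1) by blast
      have "F i u + real (card (A - L)) * (1 / real n) < F i 1" if "i \<in> A - L" for i
        using right_share[OF that, of u] zR[OF that] u by simp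
      moreover have "A - L \<noteq> {}"
        using R k by (metis card.empty zero_less_diff less_irrefl)
      ultimately have "divides F (1 / real n) (A - L) u 1"
        using right[of u] u z by (meson all_not_in_conv less_eq_real_def less_trans)
      with u show ?thesis by blast
    next
      case False
      then have sR: "s \<in> A - L"
        using s by simp
      then have "z < m s"
        using zR s by force
      then have "F s z + real (card (A - L)) * (1 / real n) < F s 1"
        using right_share[OF sR, of z] z by simp
      then have "divides F (1 / real n) (A - L) z 1"
        using z sR by (intro right right_ge) auto
      \<comment> \<open>Symmetrically, every mark in \<open>L\<close> is at most
        \<open>z < u\<close>.\<close>
      then obtain u where u: "z < u" "u < 1" "divides F (1 / real n) (A - L) u 1"
        using divides_shrink_left[of F "1 / real n" "A - L" z 1] cont by blast
      have "F i 0 + real (card L) * (1 / real n) < F i u" if "i \<in> L" for i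
        using left_share[OF that, of u] zL[OF that] u by simp
      then have "divides F (1 / real n) L 0 u"
        using left[of u] u z \<open>L \<noteq> {}\<close> by (meson all_not_in_conv less_eq_real_def less_trans)
      with u show ?thesis by blast
    qed
  qed
  then obtain u where "divides F (1 / real n) L 0 u" "divides F (1 / real n) (A - L) u 1"
    by blast
  then have "divides F (1 / real n) (L \<union> (A - L)) 0 1"
    by (rule divides.concat) auto
  then show ?thesis
    using L(1) by (simp add: Un_absorb1)
qed

section \<open>Allocations\<close>

lemma frontier_Icc_real: "a < b \<Longrightarrow> frontier {a..b::real} = {a, b}"
  by (auto simp: frontier_def)

lemma divides_imp_allocation:
  assumes val: "\<And>i. i \<in> {1..n} \<Longrightarrow> valuation (V i)"
    and w: "\<And>i. i \<in> {1..n} \<Longrightarrow> w i = t"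
    and d: "divides (\<lambda>i x. V i {0..x}) t {1..n} 0 1"
  shows "\<exists>X. connected_allocation n X \<and> strongly_proportional n V w X"
proof -
  obtain l r where
    lr: "\<forall>i\<in>{1..n}. 0 \<le> l i \<and> l i < r i \<and> r i \<le> 1 \<and> V i {0..l i} + t < V i {0..r i}"
    and un: "(\<Union>i\<in>{1..n}. {l i..r i}) = {0..1}"
    and disj: "\<forall>i\<in>{1..n}. \<forall>j\<in>{1..n}. i \<noteq> j \<longrightarrow> r i \<le> l j \<or> r j \<le> l i"
    using divides_pieces[OF d] by (elim exE conjE)
  have "finite_union_of_closed_intervals {l i..r i}" if "i \<in> {1..n}" for i
    unfolding finite_union_of_closed_intervals_def
    using bspec[OF lr that] by (intro exI[of _ "{{l i..r i}}"]) (auto intro!: exI[of _ "l i"] exI[of _ "r i"])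
  \<comment> \<open>Ordered pieces meet in at most a common endpoint; since
    \<open>l i < r i\<close>, the frontier of a piece consists of its two endpoints.\<close>
  moreover have "{l i..r i} \<inter> {l j..r j} \<subseteq> frontier {l i..r i} \<inter> frontier {l j..r j}"
    if "i \<in> {1..n}" "j \<in> {1..n}" "i \<noteq> j" for i j
    using bspec[OF lr that(1)] bspec[OF lr that(2)] bspec[OF bspec[OF disj that(1)] that(2)] that(3)
    by (auto simp: frontier_Icc_real)
  ultimately have "connected_allocation n (\<lambda>i. {l i..r i})"
    using un by (simp add: connected_allocation_def allocation_def cake_def is_interval_cc)
  moreover have "strongly_proportional n V w (\<lambda>i. {l i..r i})"
    unfolding strongly_proportional_def
  proof
    fix i assume i: "i \<in> {1..n}"
    show "w i < V i {l i..r i}"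
      using valuation_Icc[OF val[OF i], of "l i" "r i"] bspec[OF lr i] w[OF i] by simp
  qed
  ultimately show ?thesis by blast
qed

text \<open>A finite union of closed bounded intervals is compact, and a compact connected set of
  reals is a closed interval.\<close>

lemma connected_piece_Icc:
  assumes "finite_union_of_closed_intervals X" "is_interval X" "X \<noteq> {}"
  obtains a b where "a \<le> b" "X = {a..b::real}"
proof -
  obtain F where F: "finite F" "\<forall>I\<in>F. \<exists>a b. a \<le> b \<and> I = {a..b}" "X = \<Union>F"
    using assms(1) unfolding finite_union_of_closed_intervals_def by blast
  have "compact X"
    unfolding F(3) using F(1,2) by (intro compact_Union) auto
  moreover have "connected X"
    using assms(2) by (simp add: is_interval_connected_1)
  ultimately obtain a b where "X = {a..b}"
    using connected_compact_interval_1[of X] by blast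
  then show thesis
    using that assms(3) by (metis atLeastatMost_empty_iff)
qed

lemma mark_in_interior:
  assumes n: "0 < n" and V: "valuation V" and h: "hungry V"
    and ab: "0 \<le> a" "a \<le> b" "b \<le> 1" and gt: "1 / real n < V {a..b}"
  shows "\<exists>k\<in>{1..n - 1}. \<exists>x. is_mark V (real k / real n) x \<and> a < x \<and> x < b"
proof -
  let ?F = "\<lambda>x. V {0..x}"
  have gt': "?F a + 1 / real n < ?F b"
    using gt valuation_Icc[OF V ab] by simp
  have mono: "?F u \<le> ?F v" if "0 \<le> u" "u \<le> v" "v \<le> 1" for u v
    using strict_mono_on_leD[OF hungry_strict_mono[OF V h]] that by auto
  have Fa: "0 \<le> ?F a"
    using ab by (intro valuation_nonneg[OF V]) (auto simp: is_interval_cc)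
  have "?F b \<le> ?F 1"
    using mono[of b 1] ab by simp
  then have Fb: "?F b \<le> 1"
    using V by (simp add: valuation_def cake_def)
  \<comment> \<open>The least integer strictly above \<open>n * V {0..a}\<close>: the floor plus one
    keeps the mark off \<open>a\<close> even when that product is an integer. It exceeds the product
    by at most 1, so \<open>k / n\<close> stays below \<open>V {0..b}\<close>.\<close>
  define k where "k = nat \<lfloor>?F a * real n\<rfloor> + 1"
  have k_real: "real k = of_int \<lfloor>?F a * real n\<rfloor> + 1"
    using Fa by (simp add: k_def)
  have k1: "?F a * real n < real k" and k2: "real k \<le> ?F a * real n + 1"
    unfolding k_real by linarith+
  have lo: "?F a < real k / real n"
    using k1 n by (simp add: field_simps)
  have hi: "real k / real n < ?F b"
  proof -
    have "real k / real n \<le> ?F a + 1 / real n"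
      using k2 n by (simp add: field_simps)
    then show ?thesis using gt' by simp
  qed
  have "real k / real n < 1"
    using hi Fb by simp
  then have "k < n"
    using n by (simp add: field_simps)
  then have "k \<in> {1..n - 1}"
    by (simp add: k_def)
  moreover have "continuous_on {a..b} ?F"
    using V ab by (auto simp: valuation_def cake_def intro: continuous_on_subset)
  then obtain x where x: "a \<le> x" "x \<le> b" "?F x = real k / real n"
    using IVT'[of ?F a "real k / real n" b] lo hi ab by auto
  then have "x \<noteq> a" "x \<noteq> b"
    using lo hi by auto
  then have "is_mark V (real k / real n) x \<and> a < x \<and> x < b"
    using x ab by (auto simp: is_mark_def cake_def)
  ultimately show ?thesis by blast
qed

lemma different_marks_if_allocation:
  assumes n: "0 < n"
    and val: "\<And>i. i \<in> {1..n} \<Longrightarrow> valuation (V i)" and h: "\<And>i. i \<in> {1..n} \<Longrightarrow> hungry (V i)"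
    and w: "\<And>i. i \<in> {1..n} \<Longrightarrow> w i = 1 / real n"
    and X: "connected_allocation n X" "strongly_proportional n V w X"
  shows "\<exists>i\<in>{1..n}. \<exists>j\<in>{1..n}. \<exists>k\<in>{1..n - 1}. i \<noteq> j \<and>
    (\<exists>x y. is_mark (V i) (real k / real n) x \<and> is_mark (V j) (real k / real n) y \<and> x \<noteq> y)"
proof -
  have "\<exists>k\<in>{1..n - 1}. \<exists>x. is_mark (V i) (real k / real n) x \<and> x \<in> interior (X i)"
    if i: "i \<in> {1..n}" for i
  proof -
    have gt: "1 / real n < V i (X i)"
      using X(2) w[OF i] i unfolding strongly_proportional_def by metis
    \<comment> \<open>The empty set is an interval and an empty union, so it must be excluded as a
      piece: it is worth 0.\<close>
    moreover have "0 \<le> 1 / real n"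
      by simp
    ultimately have "X i \<noteq> {}"
      using valuation_empty[OF val[OF i]] by (metis not_less)
    moreover have "finite_union_of_closed_intervals (X i)" "is_interval (X i)" "X i \<subseteq> {0..1}"
      using X(1) i by (auto simp: connected_allocation_def allocation_def cake_def)
    ultimately obtain a b where ab: "a \<le> b" "X i = {a..b}"
      using connected_piece_Icc by metis
    moreover have "0 \<le> a" "b \<le> 1"
      using \<open>X i \<subseteq> {0..1}\<close> ab by auto
    ultimately show ?thesis
      using mark_in_interior[OF n val[OF i] h[OF i], of a b] gt
      by (auto simp: interior_atLeastAtMost_real)
  qed
  then obtain k x where k: "\<And>i. i \<in> {1..n} \<Longrightarrow> k i \<in> {1..n - 1}"
    and x: "\<And>i. i \<in> {1..n} \<Longrightarrow> is_mark (V i) (real (k i) / real n) (x i) \<and> x i \<in> interior (X i)"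
    by metis
  \<comment> \<open>Pigeonhole: \<open>n\<close> agents, but only \<open>n - 1\<close> indices. For
    \<open>n = 1\<close> there is no index at all.\<close>
  have "\<not> inj_on k {1..n}"
  proof
    assume "inj_on k {1..n}"
    moreover have "k ` {1..n} \<subseteq> {1..n - 1}"
      using k by blast
    ultimately have "card {1..n} \<le> card {1..n - 1}"
      by (intro card_inj_on_le) auto
    then show False using n by simp
  qed
  then obtain i j where ij: "i \<in> {1..n}" "j \<in> {1..n}" "i \<noteq> j" "k i = k j"
    by (auto simp: inj_on_def)
  have "X i \<inter> X j \<subseteq> frontier (X i)"
    using X(1) ij by (auto simp: connected_allocation_def allocation_def)
  \<comment> \<open>Points common to both pieces lie on the frontier, hence in neither interior;
    marks in the two interiors therefore differ.\<close>
  then have "interior (X i) \<inter> interior (X j) = {}"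
    using interior_subset by (fastforce simp: frontier_def)
  then have "x i \<noteq> x j"
    using x[OF ij(1)] x[OF ij(2)] by auto
  then show ?thesis
    using x[OF ij(1)] x[OF ij(2)] ij k[OF ij(1)] by metis
qed

theorem theorem1:
  fixes n :: nat
    and V :: "nat \<Rightarrow> real set \<Rightarrow> real"
    and w :: "nat \<Rightarrow> real"
  assumes "cake_instance n V w"
    and "\<forall>i\<in>{1..n}. hungry (V i)"
    and "\<forall>i\<in>{1..n}. w i = 1 / real n"
  shows "(\<exists>X. connected_allocation n X \<and> strongly_proportional n V w X) \<longleftrightarrow>
    (\<exists>i\<in>{1..n}. \<exists>j\<in>{1..n}. i \<noteq> j \<and>
      (\<exists>r\<in>{real k / real n | k. k \<in> {1..n - 1}}.
        \<exists>x y. is_mark (V i) r x \<and> is_mark (V j) r y \<and> x \<noteq> y))"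
proof
  have val: "valuation (V i)" and h: "hungry (V i)" and w: "w i = 1 / real n" if "i \<in> {1..n}" for i
    using assms that by (auto simp: cake_instance_def)
  \<comment> \<open>For \<open>n = 0\<close> the entitlements would sum to 0 instead of 1.\<close>
  have "0 < n"
    using assms(1) by (cases n) (auto simp: cake_instance_def)
  assume "\<exists>X. connected_allocation n X \<and> strongly_proportional n V w X"
  then obtain X where X: "connected_allocation n X" "strongly_proportional n V w X"
    by blast
  obtain i j k x y where "i \<in> {1..n}" "j \<in> {1..n}" "k \<in> {1..n - 1}" "i \<noteq> j"
    "is_mark (V i) (real k / real n) x" "is_mark (V j) (real k / real n) y" "x \<noteq> y"
    using different_marks_if_allocation[of n V w X, OF \<open>0 < n\<close> val h w X] by blast
  then show "\<exists>i\<in>{1..n}. \<exists>j\<in>{1..n}. i \<noteq> j \<and>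
      (\<exists>r\<in>{real k / real n | k. k \<in> {1..n - 1}}.
        \<exists>x y. is_mark (V i) r x \<and> is_mark (V j) r y \<and> x \<noteq> y)"
    by blast
next
  have val: "valuation (V i)" and h: "hungry (V i)" and w: "w i = 1 / real n" if "i \<in> {1..n}" for i
    using assms that by (auto simp: cake_instance_def)
  assume "\<exists>i\<in>{1..n}. \<exists>j\<in>{1..n}. i \<noteq> j \<and>
      (\<exists>r\<in>{real k / real n | k. k \<in> {1..n - 1}}.
        \<exists>x y. is_mark (V i) r x \<and> is_mark (V j) r y \<and> x \<noteq> y)"
  then obtain p q k x y where pq: "p \<in> {1..n}" "q \<in> {1..n}" and k: "k \<in> {1..n - 1}"
    and xy: "is_mark (V p) (real k / real n) x" "is_mark (V q) (real k / real n) y" "x \<noteq> y"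
    by blast
  have k': "0 < k" "k < n"
    using k by auto
  have ex1: "\<exists>!x. is_mark (V i) (real k / real n) x" if "i \<in> {1..n}" for i
    using k' by (intro is_mark_ex1 val h that) auto
  then obtain m where m: "\<And>i. i \<in> {1..n} \<Longrightarrow> is_mark (V i) (real k / real n) (m i)"
    by metis
  \<comment> \<open>By uniqueness of marks, the chosen \<open>m p\<close> and \<open>m q\<close> are
    the given \<open>x\<close> and \<open>y\<close>.\<close>
  have "m p \<noteq> m q"
    using ex1 m pq xy by metis
  then have "divides (\<lambda>i x. V i {0..x}) (1 / real n) {1..n} 0 1"
    using pq k' m val hungry_strict_mono[OF val h]
    by (intro divides_if_different_marks[where k = k and m = m and p = p and q = q])
      (auto simp: is_mark_def cake_def valuation_def)
  then show "\<exists>X. connected_allocation n X \<and> strongly_proportional n V w X"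
    using divides_imp_allocation[of n V w "1 / real n"] val w by blast
qed

end
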